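(* Let $d\ge 2$ and $n\ge 1$ be integers and let $\rho_{ABS}$ be a tripartite mixed state (density operator) on $\mathbb{C}^d\otimes\mathbb{C}^d\otimes\mathbb{C}^n$ shared by parties $A$, $B$, $S$. Then $$A_G(\rho_{ABS})\ \le\ G_a(\rho_{ABS}),$$ where $A_G$ is the assisted G-concurrence and $G_a$ is the G-concurrence of assistance.
   Context: G-concurrence: for a (possibly sub-normalized) vector $|\phi\rangle=\sum_{i,j=1}^d a_{ij}|i\rangle|j\rangle\in\mathbb{C}^d\otimes\mathbb{C}^d$ with coefficient matrix $A=(a_{ij})$, $G(|\phi\rangle)=d\,[\mathrm{Det}(A^\dagger A)]^{1/d}$. For a density operator $\rho$ on $\mathbb{C}^d\otimes\mathbb{C}^d$, $G(\rho)=\min\sum_i p_iG(|\psi_i\rangle)$ over all finite decompositions $\rho=\sum_i p_i|\psi_i\rangle\langle\psi_i|$ into normalized pure states with probabilities $p_i$. G-concurrence of assistance: for a normalized pure state $|\psi\rangle_{ABS}\in\mathbb{C}^d\otimes\mathbb{C}^d\otimes\mathbb{C}^n$ with $\rho_{AB}=\mathrm{Tr}_S|\psi\rangle\langle\psi|$, $G_a(|\psi\rangle_{ABS})=\max\sum_i p_i\,G(|\phi_i\rangle_{AB})$ over all finite decompositions $\rho_{AB}=\sum_i p_i|\phi_i\rangle\langle\phi_i|$ into normalized pure states with probabilities $p_i$. For a mixed state, $G_a(\rho_{ABS})=\min\sum_j q_j\,G_a(|\psi_j\rangle_{ABS})$ over all finite decompositions $\rho_{ABS}=\sum_j q_j|\psi_j\rangle\langle\psi_j|$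 into normalized pure states with probabilities $q_j$. Local operation: a finite family of maps $\varepsilon_k(\rho)=\sum_j \hat M_{k,j}\rho\hat M_{k,j}^\dagger$, with Kraus operators acting on one party's space only (those of $A$ or $B$ map $\mathbb{C}^d$ to $\mathbb{C}^d$; those of $S$ map $\mathbb{C}^n$ to $\mathbb{C}^n$), and $\sum_{k,j}\hat M_{k,j}^\dagger\hat M_{k,j}= I$; outcome $k$ occurs with probability $p_k=\mathrm{Tr}\,\varepsilon_k(\rho)$ and leaves the state $\varepsilon_k(\rho)/p_k$. A tripartite LOCC protocol is a finite sequence of local operations by $A$, $B$, $S$, in which the choice of each operation (and of the acting party) may depend on all previous outcomes; applied to $\rho_{ABS}$ it produces an ensemble $\{q_j,\sigma^j_{ABS}\}$ of tripartite states. Assisted G-concurrence: $A_G(\rho_{ABS})=\max\sum_j q_j\,G(\sigma^j_{AB})$ with $\sigma^j_{AB}=\mathrm{Tr}_S\,\sigma^j_{ABS}$, the maximum (understood as a supremum) being over all ensembles $\{q_j,\sigma^j_{ABS}\}$ obtainable from $\rho_{ABS}$ by a tripartite LOCC protocol. *)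

theory Defs
  imports "HOL-Analysis.Analysis"
begin

text \<open>
  The spaces of \<open>A\<close> and \<open>B\<close> are \<open>complex ^ 'd\<close>, that of \<open>S\<close> is \<open>complex ^ 'n\<close>. Tensor products are
  spaces of vectors indexed by tuples: \<open>complex ^ ('d \<times> 'd)\<close> for \<open>AB\<close> and
  \<open>complex ^ ('d \<times> 'd \<times> 'n)\<close> for \<open>ABS\<close>.
\<close>

type_synonym 'i operator = "complex ^ 'i ^ 'i"

definition dagger :: "complex ^ 'a ^ 'b \<Rightarrow> complex ^ 'b ^ 'a" where
  "dagger A = (\<chi> i j. cnj (A $ j $ i))"

definition ketbra :: "complex ^ 'i::finite \<Rightarrow> 'i operator" where
  "ketbra v = (\<chi> i j. v $ i * cnj (v $ j))"

definition density_operator :: "('i::finite) operator \<Rightarrow> bool" where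
  "density_operator \<rho> \<longleftrightarrow>
     dagger \<rho> = \<rho> \<and>
     (\<forall>v. 0 \<le> Re (\<Sum>i\<in>UNIV. cnj (v $ i) * (\<rho> *v v) $ i)) \<and>
     trace \<rho> = 1"

definition pure_decompositions ::
    "('i::finite) operator \<Rightarrow> (real \<times> (complex ^ 'i)) list set" where
  "pure_decompositions \<rho> = {D.
     (\<forall>(p, \<psi>) \<in> set D. 0 \<le> p \<and> norm \<psi> = 1) \<and>
     (\<Sum>(p, \<psi>)\<leftarrow>D. p) = 1 \<and>
     \<rho> = (\<Sum>(p, \<psi>)\<leftarrow>D. p *\<^sub>R ketbra \<psi>)}"

definition ptrace_S ::
    "('d::finite \<times> 'd \<times> 'n::finite) operator \<Rightarrow> ('d \<times> 'd) operator" where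
  "ptrace_S \<rho> = (\<chi> x y. \<Sum>s\<in>UNIV. \<rho> $ (fst x, snd x, s) $ (fst y, snd y, s))"


subsection \<open>G-concurrence and G-concurrence of assistance\<close>

definition coeff_matrix :: "complex ^ ('d::finite \<times> 'd) \<Rightarrow> complex ^ 'd ^ 'd" where
  "coeff_matrix \<phi> = (\<chi> i j. \<phi> $ (i, j))"

text \<open>The determinant below is \<open>\<bar>Det A\<bar>\<^sup>2\<close>, a nonnegative real, so taking \<open>Re\<close> loses nothing.\<close>

definition G_pure :: "complex ^ ('d::finite \<times> 'd) \<Rightarrow> real" where
  "G_pure \<phi> = real CARD('d) *
     root CARD('d) (Re (det (dagger (coeff_matrix \<phi>) ** coeff_matrix \<phi>)))"

text \<open>
  The minima and maxima over decompositions are written as \<open>Inf\<close> and \<open>Sup\<close>. For a density operator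
  the set of decompositions is nonempty, and \<open>0 \<le> G_pure \<phi> \<le> 1\<close> for normalized \<open>\<phi>\<close>, so these are
  genuine infima and suprema.
\<close>

definition G_conc :: "('d::finite \<times> 'd) operator \<Rightarrow> real" where
  "G_conc \<rho> = (INF D \<in> pure_decompositions \<rho>. \<Sum>(p, \<psi>)\<leftarrow>D. p * G_pure \<psi>)"

definition G_assist_pure :: "complex ^ ('d::finite \<times> 'd \<times> 'n::finite) \<Rightarrow> real" where
  "G_assist_pure \<psi> =
     (SUP D \<in> pure_decompositions (ptrace_S (ketbra \<psi>)). \<Sum>(p, \<phi>)\<leftarrow>D. p * G_pure \<phi>)"

definition G_assist :: "('d::finite \<times> 'd \<times> 'n::finite) operator \<Rightarrow> real" where
  "G_assist \<rho> = (INF D \<in> pure_decompositions \<rho>. \<Sum>(q, \<psi>)\<leftarrow>D. q * G_assist_pure \<psi>)"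


subsection \<open>LOCC protocols\<close>

definition tensor3 ::
    "('d::finite) operator \<Rightarrow> 'd operator \<Rightarrow> ('n::finite) operator \<Rightarrow> ('d \<times> 'd \<times> 'n) operator" where
  "tensor3 P Q R = (\<chi> x y. P $ fst x $ fst y *
                           Q $ fst (snd x) $ fst (snd y) *
                           R $ snd (snd x) $ snd (snd y))"

text \<open>
  A family of completely positive maps is given by a list of lists of Kraus operators: the \<open>k\<close>-th
  inner list contains the operators \<open>M\<^bsub>k,j\<^esub>\<close> of the \<open>k\<close>-th outcome.
\<close>

type_synonym 'i kraus_family = "'i operator list list"

definition complete_kraus :: "('i::finite) kraus_family \<Rightarrow> bool" where
  "complete_kraus Ms \<longleftrightarrow> (\<Sum>M\<leftarrow>concat Ms. dagger M ** M) = mat 1"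

definition local_operation :: "('d::finite \<times> 'd \<times> 'n::finite) kraus_family \<Rightarrow> bool" where
  "local_operation Ks \<longleftrightarrow>
     (\<exists>Ms. complete_kraus Ms \<and> Ks = map (map (\<lambda>M. tensor3 M (mat 1) (mat 1))) Ms) \<or>
     (\<exists>Ms. complete_kraus Ms \<and> Ks = map (map (\<lambda>M. tensor3 (mat 1) M (mat 1))) Ms) \<or>
     (\<exists>Ms. complete_kraus Ms \<and> Ks = map (map (\<lambda>M. tensor3 (mat 1) (mat 1) M)) Ms)"

definition apply_kraus :: "('i::finite) operator list \<Rightarrow> 'i operator \<Rightarrow> 'i operator" where
  "apply_kraus Ms \<rho> = (\<Sum>M\<leftarrow>Ms. M ** \<rho> ** dagger M)"

definition outcome_prob :: "('i::finite) operator list \<Rightarrow> 'i operator \<Rightarrow> real" where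
  "outcome_prob Ms \<rho> = Re (trace (apply_kraus Ms \<rho>))"

text \<open>
  A protocol of \<open>m\<close> rounds is a function \<open>P\<close> assigning to each list of previous outcomes (earliest
  first) the local operation performed next, including the acting party. Outcomes of probability
  zero do not occur and are dropped.
\<close>

type_synonym 'i protocol = "nat list \<Rightarrow> 'i kraus_family"

primrec run_protocol ::
    "nat \<Rightarrow> ('i::finite) protocol \<Rightarrow> 'i operator \<Rightarrow> (real \<times> 'i operator) list" where
  "run_protocol 0 P \<rho> = [(1, \<rho>)]"
| "run_protocol (Suc m) P \<rho> =
     concat (map (\<lambda>k. let Ms = P [] ! k; p = outcome_prob Ms \<rho> in
         if p > 0
         then map (\<lambda>(q, \<sigma>). (p * q, \<sigma>))
                (run_protocol m (\<lambda>h. P (k # h)) ((1 / p) *\<^sub>R apply_kraus Ms \<rho>))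
         else [])
       [0..<length (P [])])"

definition locc_ensembles ::
    "('d::finite \<times> 'd \<times> 'n::finite) operator \<Rightarrow>
     (real \<times> ('d \<times> 'd \<times> 'n) operator) list set" where
  "locc_ensembles \<rho> = {run_protocol m P \<rho> | m P. \<forall>h. local_operation (P h)}"

definition assisted_G :: "('d::finite \<times> 'd \<times> 'n::finite) operator \<Rightarrow> real" where
  "assisted_G \<rho> = (SUP E \<in> locc_ensembles \<rho>. \<Sum>(q, \<sigma>)\<leftarrow>E. q * G_conc (ptrace_S \<sigma>))"

end

theory Submission
  imports Defs
begin

text \<open>
  In unnormalised form \<open>G_pure\<close> is quadratic under scaling, and \<open>A \<otimes> B\<close> multiplies it by
  \<open>\<bar>det A\<bar>\<^bsup>2/d\<^esup> \<bar>det B\<bar>\<^bsup>2/d\<^esup>\<close>. Hadamard's inequality and AM-GM give \<open>d \<bar>det M\<bar>\<^bsup>2/d\<^esup> \<le> tr (M\<^sup>\<dagger> M)\<close>, so the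
  factors \<open>\<bar>det M\<bar>\<^bsup>2/d\<^esup>\<close> of a local operation by \<open>A\<close> or \<open>B\<close> add up to at most \<open>1\<close>. An operation by \<open>S\<close>
  does not change \<open>\<rho>\<^bsub>AB\<^esub>\<close>, it only splits it into a sum, and the supremum over decompositions is
  superadditive. Hence no protocol applied to a pure state beats its concurrence of assistance. For a
  mixed state, every decomposition into pure states is propagated through the protocol; slicing the
  resulting vectors along a basis of \<open>S\<close> decomposes each final \<open>\<sigma>\<^bsub>AB\<^esub>\<close> and so bounds its
  concurrence from above.
\<close>

subsection \<open>Hadamard's inequality\<close>

lemma norm_sq_vec:
  fixes v :: "complex ^ 'n"
  shows "(norm v)\<^sup>2 = (\<Sum>i\<in>UNIV. (cmod (v $ i))\<^sup>2)"
  by (simp add: norm_vec_def L2_set_def sum_nonneg)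

lemma of_real_norm_sq_vec:
  fixes v :: "complex ^ 'n"
  shows "of_real ((norm v)\<^sup>2) = (\<Sum>i\<in>UNIV. v $ i * cnj (v $ i))"
  by (simp add: norm_sq_vec flip: complex_norm_square)

lemma norm_axis:
  fixes a :: complex
  shows "norm (axis i a :: complex ^ 'n) = cmod a"
proof -
  have "(norm (axis i a :: complex ^ 'n))\<^sup>2 = (\<Sum>j\<in>UNIV. if j = i then (cmod a)\<^sup>2 else 0)"
    unfolding norm_sq_vec by (rule sum.cong) (auto simp: axis_def)
  then show ?thesis by simp
qed

lemma norm_vector_smult:
  fixes v :: "complex ^ 'n"
  shows "norm (c *s v) = cmod c * norm v"
  by (simp add: norm_vec_def L2_set_right_distrib norm_mult)

lemma det_dagger: "det (dagger M) = cnj (det M)"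
proof -
  have "dagger M = transpose (\<chi> i j. cnj (M $ i $ j))"
    by (simp add: dagger_def transpose_def)
  then have "det (dagger M) = det (\<chi> i j. cnj (M $ i $ j))"
    by simp
  then show ?thesis
    by (simp add: det_def)
qed

lemma row_eq_nth: "row i A = A $ i"
  by (simp add: row_def)

text \<open>A maximiser of \<open>cmod (det M)\<close> over unit rows exists by compactness. Its
  rows are orthogonal: subtracting from one row its projection onto another keeps the determinant
  but shortens that row, and renormalising would beat the maximum. Hence the maximiser is
  unitary.\<close>

lemma cmod_det_le_1:
  fixes M :: "complex ^ 'n::finite ^ 'n"
  assumes "\<And>i. norm (M $ i) = 1"
  shows "cmod (det M) \<le> 1"
proof -
  define S where "S = {M :: complex ^ 'n ^ 'n. \<forall>i. norm (M $ i) = 1}"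
  have "closed S"
    unfolding S_def by (intro closed_Collect_all closed_Collect_eq continuous_intros)
  moreover have "bounded S"
  proof -
    have "norm M \<le> real CARD('n)" if "M \<in> S" for M
    proof -
      have "norm M \<le> (\<Sum>i\<in>UNIV. norm (M $ i))"
        unfolding norm_vec_def[of M] by (rule L2_set_le_sum) simp
      then show ?thesis using that by (simp add: S_def)
    qed
    then show ?thesis unfolding bounded_iff by blast
  qed
  ultimately have "compact S" by (simp add: compact_eq_bounded_closed)
  moreover have idS: "mat 1 \<in> S"
  proof -
    have "norm ((mat 1 :: complex ^ 'n ^ 'n) $ i) = 1" for i
    proof -
      have "(mat 1 :: complex ^ 'n ^ 'n) $ i = axis i 1"
        by (auto simp: mat_def axis_def vec_eq_iff)
      then show ?thesis by (simp add: norm_axis)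
    qed
    then show ?thesis by (simp add: S_def)
  qed
  moreover have "continuous_on S (\<lambda>M. cmod (det M))"
    unfolding det_def by (intro continuous_intros)
  ultimately obtain M0 where M0: "M0 \<in> S" and
    max: "\<And>M. M \<in> S \<Longrightarrow> cmod (det M) \<le> cmod (det M0)"
    using continuous_attains_sup[of S "\<lambda>M. cmod (det M)"] by blast
  \<comment> \<open>The identity competes, so the maximiser is nonsingular; this excludes
    \<open>u = 0\<close> below.\<close>
  have ge1: "cmod (det M0) \<ge> 1" using max[OF idS] by simp
  have orth: "(\<Sum>k\<in>UNIV. M0 $ i $ k * cnj (M0 $ j $ k)) = 0" if "i \<noteq> j" for i j
  proof (rule ccontr)
    define h where "h = (\<Sum>k\<in>UNIV. M0 $ i $ k * cnj (M0 $ j $ k))"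
    assume "(\<Sum>k\<in>UNIV. M0 $ i $ k * cnj (M0 $ j $ k)) \<noteq> 0"
    then have h0: "h \<noteq> 0" by (simp add: h_def)
    \<comment> \<open>Row \<open>j\<close> is a unit vector, so \<open>u\<close> is row
      \<open>i\<close> minus its orthogonal projection onto row \<open>j\<close>.\<close>
    define u where "u = M0 $ i + (- h) *s M0 $ j"
    define N where "N = (\<chi> k. if k = i then u else M0 $ k)"
    have detN: "det N = det M0"
      using det_row_operation[OF that, of M0 "- h"] unfolding N_def u_def row_eq_nth .
    have n1: "(\<Sum>k\<in>UNIV. M0 $ l $ k * cnj (M0 $ l $ k)) = 1" for l
      using of_real_norm_sq_vec[of "M0 $ l"] M0 by (simp add: S_def)
    have hc: "cnj h = (\<Sum>k\<in>UNIV. M0 $ j $ k * cnj (M0 $ i $ k))"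
      by (simp add: h_def cnj_sum mult.commute)
    have "of_real ((norm u)\<^sup>2) =
        (\<Sum>k\<in>UNIV. M0 $ i $ k * cnj (M0 $ i $ k) - cnj h * (M0 $ i $ k * cnj (M0 $ j $ k))
           - h * (M0 $ j $ k * cnj (M0 $ i $ k)) + h * cnj h * (M0 $ j $ k * cnj (M0 $ j $ k)))"
      unfolding of_real_norm_sq_vec u_def by (rule sum.cong) (simp_all add: algebra_simps)
    also have "\<dots> = 1 - cnj h * h - h * cnj h + h * cnj h"
      by (simp add: sum.distrib sum_subtractf n1 flip: sum_distrib_left hc h_def)
    also have "\<dots> = of_real (1 - (cmod h)\<^sup>2)"
      by (simp add: mult.commute flip: complex_norm_square)
    finally have nu: "(norm u)\<^sup>2 = 1 - (cmod h)\<^sup>2"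
      by (simp only: of_real_eq_iff)
    have u0: "u \<noteq> 0"
    proof
      assume "u = 0"
      then have "det N = 0"
        by (intro det_zero_row(2)[of i]) (simp add: N_def row_eq_nth)
      with detN ge1 show False by simp
    qed
    \<comment> \<open>Restoring unit length divides the determinant by \<open>norm u\<close>, so
      maximality forces \<open>norm u\<close> to be at least 1, against
      \<open>(norm u)\<^sup>2 = 1 - (cmod h)\<^sup>2\<close>.\<close>
    define N' where
      "N' = (\<chi> k. if k = i then complex_of_real (1 / norm u) *s u else M0 $ k)"
    have "N' \<in> S"
      using M0 u0 by (simp add: S_def N'_def norm_vector_smult norm_divide)
    moreover have "det N' = complex_of_real (1 / norm u) * det N"
      unfolding N'_def N_def by (rule det_row_mul)
    ultimately have "cmod (det M0) / norm u \<le> cmod (det M0)"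
      using max[of N'] by (simp add: detN norm_mult norm_divide)
    then have "1 \<le> norm u"
      using ge1 u0 by (auto simp: divide_le_eq mult_le_cancel_left1)
    then have "1 \<le> (norm u)\<^sup>2" by simp
    with nu h0 show False by simp
  qed
  have "M0 ** dagger M0 = mat 1"
  proof -
    have "(M0 ** dagger M0) $ i $ j = (mat 1 :: complex ^ 'n ^ 'n) $ i $ j" for i j
    proof (cases "i = j")
      case True
      then show ?thesis
        using of_real_norm_sq_vec[of "M0 $ j"] M0
        by (simp add: matrix_matrix_mult_def dagger_def mat_def S_def)
    next
      case False
      then show ?thesis using orth[of i j]
        by (simp add: matrix_matrix_mult_def dagger_def mat_def)
    qed
    then show ?thesis by (simp add: vec_eq_iff)
  qed
  then have "det M0 * cnj (det M0) = 1"
    by (metis det_mul det_I det_dagger)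
  then have "(cmod (det M0))\<^sup>2 = 1"
    by (metis complex_norm_square of_real_eq_1_iff)
  then have "cmod (det M0) = 1"
    by (metis norm_ge_zero power2_eq_1_iff zero_le_one abs_of_nonneg abs_one abs_minus_cancel)
  then show ?thesis using max[of M] assms by (simp add: S_def)
qed

text \<open>Both sides scale alike in each row, which reduces nonzero rows to unit rows; a zero row
  kills the determinant.\<close>

lemma hadamard_inequality:
  fixes M :: "complex ^ 'n::finite ^ 'n"
  shows "cmod (det M) \<le> (\<Prod>i\<in>UNIV. norm (M $ i))"
proof (cases "\<exists>i. M $ i = 0")
  case True
  then obtain i where "row i M = 0" by (auto simp: row_eq_nth)
  then have "det M = 0" by (rule det_zero_row(2))
  then show ?thesis by (simp add: prod_nonneg)
next
  case False
  define a where "a i = complex_of_real (1 / norm (M $ i)) *s M $ i" for i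
  have "M = (\<chi> i. complex_of_real (norm (M $ i)) *s a i)"
    using False by (auto simp: a_def vec_eq_iff)
  then have "det M = (\<Prod>i\<in>UNIV. complex_of_real (norm (M $ i))) * det (\<chi> i. a i)"
    by (metis det_rows_mul)
  moreover have "cmod (det (\<chi> i. a i)) \<le> 1"
    by (rule cmod_det_le_1) (use False in \<open>simp add: a_def norm_vector_smult norm_divide\<close>)
  ultimately show ?thesis
    by (simp add: norm_mult mult_left_le prod_nonneg flip: prod_norm)
qed

section \<open>Determinant factors of local operators\<close>

definition det_root :: "complex ^ 'n::finite ^ 'n \<Rightarrow> real" where
  "det_root M = root CARD('n) ((cmod (det M))\<^sup>2)"

lemma det_root_nonneg: "0 \<le> det_root M"
  by (simp add: det_root_def)

lemma det_root_mult: "det_root (A ** B) = det_root A * det_root B"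
  by (simp add: det_root_def det_mul norm_mult power_mult_distrib real_root_mult)

lemma det_root_1: "det_root (mat 1) = 1"
  by (simp add: det_root_def)

lemma det_root_transpose: "det_root (transpose A) = det_root A"
  by (simp add: det_root_def)

text \<open>Hadamard's inequality followed by AM-GM on the squared row norms, whose sum is the
  squared Hilbert-Schmidt norm of \<open>M\<close>.\<close>

lemma det_root_le:
  fixes M :: "complex ^ 'n::finite ^ 'n"
  shows "real CARD('n) * det_root M \<le> (\<Sum>i\<in>UNIV. (norm (M $ i))\<^sup>2)"
proof -
  have "det_root M \<le> root CARD('n) (\<Prod>i\<in>UNIV. (norm (M $ i))\<^sup>2)"
    unfolding det_root_def
    using power_mono[OF hadamard_inequality[of M] norm_ge_zero, of 2]
    by (simp add: prod_power_distrib)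
  also have "\<dots> = (\<Prod>i\<in>UNIV. (norm (M $ i))\<^sup>2) powr (1 / CARD('n))"
    by (simp add: root_powr_inverse prod_nonneg)
  also have "\<dots> \<le> (\<Sum>i\<in>UNIV. (norm (M $ i))\<^sup>2 / CARD('n))"
    by (rule arith_geom_mean) auto
  finally show ?thesis
    by (simp add: field_simps flip: sum_divide_distrib)
qed

subsection \<open>Unnormalised pure-state decompositions\<close>

lemma sum_UNIV_prod: "(\<Sum>x\<in>UNIV. f x) = (\<Sum>a\<in>UNIV. \<Sum>b\<in>UNIV. f (a, b))"
  by (simp add: sum.cartesian_product flip: UNIV_Times_UNIV)

lemma Re_sum_list: "Re (\<Sum>x\<leftarrow>xs. f x) = (\<Sum>x\<leftarrow>xs. Re (f x))"
  by (induction xs) auto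

lemma trace_sum_list: "trace (\<Sum>x\<leftarrow>xs. f x) = (\<Sum>x\<leftarrow>xs. trace (f x :: complex ^ 'n ^ 'n))"
  by (induction xs) (auto simp: trace_add trace_0[simplified])

lemma trace_scaleR: "trace (c *\<^sub>R A) = complex_of_real c * trace A"
  by (simp add: trace_def sum_distrib_left scaleR_conv_of_real[where 'a = complex])

lemma G_pure_eq: "G_pure \<phi> = real CARD('d) * det_root (coeff_matrix \<phi>)"
  for \<phi> :: "complex ^ ('d::finite \<times> 'd)"
proof -
  have "Re (det (dagger M ** M)) = (cmod (det M))\<^sup>2" for M :: "complex ^ 'd ^ 'd"
    by (simp add: det_mul det_dagger cmod_power2) (simp add: power2_eq_square)
  then show ?thesis by (simp add: G_pure_def det_root_def)
qed

lemma G_pure_nonneg: "0 \<le> G_pure \<phi>"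
  by (simp add: G_pure_eq det_root_nonneg)

text \<open>The Hilbert-Schmidt norm of the coefficient matrix is the norm of the vector. This bound
  keeps the suprema over decompositions finite.\<close>

lemma G_pure_le: "G_pure \<phi> \<le> (norm \<phi>)\<^sup>2"
  using det_root_le[of "coeff_matrix \<phi>"]
  by (simp add: G_pure_eq norm_sq_vec coeff_matrix_def sum_UNIV_prod)

text \<open>The determinant picks up \<open>r ^ CARD('d)\<close>, and the root of the squared
  modulus turns this into the square of \<open>r\<close>. Quadratic scaling, shared with
  \<open>ketbra\<close>, lets probabilities be absorbed into vectors.\<close>

lemma G_pure_scaleR: "G_pure (r *\<^sub>R \<phi>) = r\<^sup>2 * G_pure \<phi>"
  for \<phi> :: "complex ^ ('d::finite \<times> 'd)"
proof -
  have "coeff_matrix (r *\<^sub>R \<phi>) = (\<chi> i. complex_of_real r *s coeff_matrix \<phi> $ i)"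
    by (simp add: coeff_matrix_def vec_eq_iff scaleR_conv_of_real[where 'a = complex])
  then have "det (coeff_matrix (r *\<^sub>R \<phi>)) = complex_of_real r ^ CARD('d) * det (coeff_matrix \<phi>)"
    using det_rows_mul[of "\<lambda>_. complex_of_real r" "\<lambda>i. coeff_matrix \<phi> $ i"] by simp
  then have "(cmod (det (coeff_matrix (r *\<^sub>R \<phi>))))\<^sup>2 =
      (r\<^sup>2) ^ CARD('d) * (cmod (det (coeff_matrix \<phi>)))\<^sup>2"
    by (simp add: norm_mult norm_power power_mult_distrib power_even_abs power_commutes
        mult.commute flip: power_mult)
  then show ?thesis
    by (simp add: G_pure_eq det_root_def real_root_mult real_root_power_cancel)
qed

lemma ketbra_scaleR: "ketbra (r *\<^sub>R \<phi>) = r\<^sup>2 *\<^sub>R ketbra \<phi>"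
  by (simp add: ketbra_def vec_eq_iff power2_eq_square scaleR_conv_of_real[where 'a = complex])

lemma trace_ketbra: "trace (ketbra \<phi>) = complex_of_real ((norm \<phi>)\<^sup>2)"
  unfolding of_real_norm_sq_vec by (simp add: trace_def ketbra_def)

lemma sum_norm_sq_eq_trace: "(\<Sum>u\<leftarrow>us. (norm u)\<^sup>2) = Re (trace (\<Sum>u\<leftarrow>us. ketbra u))"
  by (simp add: trace_sum_list trace_ketbra Re_sum_list del: of_real_power)

text \<open>A vector \<open>u\<close> carries both a weight, \<open>(norm u)\<^sup>2 / c\<close>,
  and a direction; splitting the two turns a list of unnormalised vectors into a genuine
  decomposition without changing the average of a quadratically scaling \<open>f\<close>, up to the
  factor \<open>c\<close>.\<close>

lemma normalise_decomposition:
  fixes us :: "(complex ^ 'i::finite) list" and f :: "complex ^ 'i \<Rightarrow> real"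
  assumes us: "(\<Sum>u\<leftarrow>us. ketbra u) = c *\<^sub>R \<sigma>" and "trace \<sigma> = 1" "c > 0"
    and f: "\<And>r u. f (r *\<^sub>R u) = r\<^sup>2 * f u"
  obtains D where "D \<in> pure_decompositions \<sigma>"
    "(\<Sum>(p, \<psi>)\<leftarrow>D. p * f \<psi>) = (\<Sum>u\<leftarrow>us. f u) / c"
proof
  define k :: 'i where "k = undefined"
  \<comment> \<open>A zero vector gets weight 0 but still has to be paired with some unit vector; a
    basis vector serves as default.\<close>
  define e where "e u = (if u = 0 then axis k 1 else (1 / norm u) *\<^sub>R u)" for u :: "complex ^ 'i"
  define D where "D = map (\<lambda>u. ((norm u)\<^sup>2 / c, e u)) us"
  have e: "norm u *\<^sub>R e u = u" for u
    by (simp add: e_def)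
  \<comment> \<open>Taking traces: the squared norms add up to the trace of
    \<open>c *\<^sub>R \<sigma>\<close>.\<close>
  have "(\<Sum>u\<leftarrow>us. (norm u)\<^sup>2) = c"
    unfolding sum_norm_sq_eq_trace us by (simp add: trace_scaleR assms)
  then have "(\<Sum>(p, \<psi>)\<leftarrow>D. p) = 1"
    using \<open>c > 0\<close>
    by (simp add: D_def comp_def divide_inverse sum_list_mult_const)
  moreover have "\<forall>(p, \<psi>) \<in> set D. 0 \<le> p \<and> norm \<psi> = 1"
    using \<open>c > 0\<close> by (auto simp: D_def e_def norm_axis)
  moreover have "\<sigma> = (\<Sum>(p, \<psi>)\<leftarrow>D. p *\<^sub>R ketbra \<psi>)"
  proof -
    have "((norm u)\<^sup>2 / c) *\<^sub>R ketbra (e u) = (1 / c) *\<^sub>R ketbra u" for u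
      using ketbra_scaleR[of "norm u" "e u"] by (simp add: e)
    then have "(\<Sum>(p, \<psi>)\<leftarrow>D. p *\<^sub>R ketbra \<psi>) = (\<Sum>u\<leftarrow>us. (1 / c) *\<^sub>R ketbra u)"
      by (simp add: D_def comp_def)
    also have "\<dots> = (1 / c) *\<^sub>R (\<Sum>u\<leftarrow>us. ketbra u)"
      by (induction us) (auto simp: scaleR_add_right)
    finally show ?thesis using us \<open>c > 0\<close> by simp
  qed
  ultimately show "D \<in> pure_decompositions \<sigma>"
    by (simp add: pure_decompositions_def)
  have "(norm u)\<^sup>2 / c * f (e u) = f u * (1 / c)" for u
    using f[of "norm u" "e u"] by (simp add: e)
  then have "(\<Sum>(p, \<psi>)\<leftarrow>D. p * f \<psi>) = (\<Sum>u\<leftarrow>us. f u * (1 / c))"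
    unfolding D_def map_map comp_def prod.case by (intro arg_cong[of _ _ sum_list] map_cong refl)
  then show "(\<Sum>(p, \<psi>)\<leftarrow>D. p * f \<psi>) = (\<Sum>u\<leftarrow>us. f u) / c"
    by (simp add: sum_list_mult_const divide_inverse)
qed

lemma unnormalise_decomposition:
  assumes "D \<in> pure_decompositions \<sigma>"
  shows "(\<Sum>u\<leftarrow>map (\<lambda>(p, \<psi>). sqrt p *\<^sub>R \<psi>) D. ketbra u) = \<sigma>"
proof -
  have "0 \<le> p" if "(p, \<psi>) \<in> set D" for p \<psi>
    using assms that by (auto simp: pure_decompositions_def)
  then have "(\<Sum>u\<leftarrow>map (\<lambda>(p, \<psi>). sqrt p *\<^sub>R \<psi>) D. ketbra u) = (\<Sum>(p, \<psi>)\<leftarrow>D. p *\<^sub>R ketbra \<psi>)"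
    by (auto simp: ketbra_scaleR intro!: arg_cong[of _ _ sum_list])
  then show ?thesis
    using assms by (simp add: pure_decompositions_def)
qed

text \<open>\<open>G_conc\<close> is an infimum, so any single decomposition bounds it from above;
  \<open>c\<close> is the total weight of the unnormalised vectors.\<close>

lemma G_conc_le:
  assumes "(\<Sum>u\<leftarrow>us. ketbra u) = c *\<^sub>R \<sigma>" "trace \<sigma> = 1" "c > 0"
  shows "c * G_conc \<sigma> \<le> (\<Sum>u\<leftarrow>us. G_pure u)"
proof -
  obtain D where D: "D \<in> pure_decompositions \<sigma>"
    "(\<Sum>(p, \<psi>)\<leftarrow>D. p * G_pure \<psi>) = (\<Sum>u\<leftarrow>us. G_pure u) / c"
    using normalise_decomposition[OF assms, of G_pure] G_pure_scaleR by blast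
  have "bdd_below ((\<lambda>D. \<Sum>(p, \<psi>)\<leftarrow>D. p * G_pure \<psi>) ` pure_decompositions \<sigma>)"
    by (rule bdd_belowI2[of _ 0])
       (fastforce simp: pure_decompositions_def G_pure_nonneg intro!: sum_list_nonneg)
  then have "G_conc \<sigma> \<le> (\<Sum>(p, \<psi>)\<leftarrow>D. p * G_pure \<psi>)"
    unfolding G_conc_def using D(1) by (rule cINF_lower)
  then show ?thesis using D(2) \<open>c > 0\<close> by (simp add: field_simps)
qed

text \<open>Concurrence of assistance without normalisation, so that contributions of branches with
  different probabilities can simply be added. For operators that are not sums of
  \<open>ketbra\<close>s the supremum runs over the empty set, hence the existence hypotheses
  below.\<close>

definition G_upper :: "('d::finite \<times> 'd) operator \<Rightarrow> real" where
  "G_upper \<sigma> = (SUP us \<in> {us. (\<Sum>u\<leftarrow>us. ketbra u) = \<sigma>}. \<Sum>u\<leftarrow>us. G_pure u)"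

lemma sum_G_pure_le_trace: "(\<Sum>u\<leftarrow>us. G_pure u) \<le> Re (trace (\<Sum>u\<leftarrow>us. ketbra u))"
  unfolding sum_norm_sq_eq_trace[symmetric] by (rule sum_list_mono) (rule G_pure_le)

lemma le_G_upper:
  assumes "(\<Sum>u\<leftarrow>us. ketbra u) = \<sigma>"
  shows "(\<Sum>u\<leftarrow>us. G_pure u) \<le> G_upper \<sigma>"
  unfolding G_upper_def
proof (rule cSUP_upper)
  show "bdd_above ((\<lambda>us. \<Sum>u\<leftarrow>us. G_pure u) ` {us. (\<Sum>u\<leftarrow>us. ketbra u) = \<sigma>})"
    by (rule bdd_aboveI2[of _ _ "Re (trace \<sigma>)"]) (use sum_G_pure_le_trace in blast)
qed (use assms in simp)

lemma G_upper_le: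
  assumes "\<exists>us. (\<Sum>u\<leftarrow>us. ketbra u) = \<sigma>"
    and "\<And>us. (\<Sum>u\<leftarrow>us. ketbra u) = \<sigma> \<Longrightarrow> (\<Sum>u\<leftarrow>us. G_pure u) \<le> x"
  shows "G_upper \<sigma> \<le> x"
  unfolding G_upper_def by (rule cSUP_least) (use assms in auto)

text \<open>Concatenating decompositions of \<sigma> and \<tau> decomposes their sum.\<close>

lemma G_upper_add:
  assumes \<sigma>: "\<exists>us. (\<Sum>u\<leftarrow>us. ketbra u) = \<sigma>" and \<tau>: "\<exists>us. (\<Sum>u\<leftarrow>us. ketbra u) = \<tau>"
  shows "G_upper \<sigma> + G_upper \<tau> \<le> G_upper (\<sigma> + \<tau>)"
proof -
  \<comment> \<open>The two suprema are resolved one after the other, the remaining summand being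
    moved to the right as a constant.\<close>
  have "G_upper \<sigma> \<le> G_upper (\<sigma> + \<tau>) - G_upper \<tau>"
  proof (rule G_upper_le[OF \<sigma>])
    fix us :: "(complex ^ ('a \<times> 'a)) list"
    assume us: "(\<Sum>u\<leftarrow>us. ketbra u) = \<sigma>"
    have "G_upper \<tau> \<le> G_upper (\<sigma> + \<tau>) - (\<Sum>u\<leftarrow>us. G_pure u)"
    proof (rule G_upper_le[OF \<tau>])
      fix vs :: "(complex ^ ('a \<times> 'a)) list"
      assume "(\<Sum>u\<leftarrow>vs. ketbra u) = \<tau>"
      then show "(\<Sum>u\<leftarrow>vs. G_pure u) \<le> G_upper (\<sigma> + \<tau>) - (\<Sum>u\<leftarrow>us. G_pure u)"
        using le_G_upper[of "us @ vs" "\<sigma> + \<tau>"] us by simp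
    qed
    then show "(\<Sum>u\<leftarrow>us. G_pure u) \<le> G_upper (\<sigma> + \<tau>) - G_upper \<tau>" by simp
  qed
  then show ?thesis by simp
qed

lemma sum_list_G_upper_le:
  fixes F :: "'a \<Rightarrow> ('d::finite \<times> 'd) operator"
  assumes "\<And>x. x \<in> set xs \<Longrightarrow> \<exists>us. (\<Sum>u\<leftarrow>us. ketbra u) = F x"
  shows "(\<Sum>x\<leftarrow>xs. G_upper (F x)) \<le> G_upper (\<Sum>x\<leftarrow>xs. F x)"
proof -
  \<comment> \<open>Decomposability of the partial sums goes through the induction too, since
    superadditivity needs it.\<close>
  have "(\<exists>us. (\<Sum>u\<leftarrow>us. ketbra u) = (\<Sum>x\<leftarrow>xs. F x)) \<and>
      (\<Sum>x\<leftarrow>xs. G_upper (F x)) \<le> G_upper (\<Sum>x\<leftarrow>xs. F x)"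
    using assms
  proof (induction xs)
    case Nil
    have "\<exists>us. (\<Sum>u\<leftarrow>us. ketbra u) = (0 :: ('d \<times> 'd) operator)"
      by (rule exI[of _ "[]"]) simp
    then show ?case
      using le_G_upper[of "[]" 0] by simp
  next
    case (Cons x xs)
    obtain us vs where uv: "(\<Sum>u\<leftarrow>us. ketbra u) = F x"
      "(\<Sum>u\<leftarrow>vs. ketbra u) = (\<Sum>x\<leftarrow>xs. F x)"
      using Cons by (metis list.set_intros)
    then have "\<exists>ws. (\<Sum>u\<leftarrow>ws. ketbra u) = F x + (\<Sum>x\<leftarrow>xs. F x)"
      by (intro exI[of _ "us @ vs"]) simp
    moreover have "G_upper (F x) + G_upper (\<Sum>x\<leftarrow>xs. F x) \<le> G_upper (F x + (\<Sum>x\<leftarrow>xs. F x))"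
      using uv by (intro G_upper_add) auto
    ultimately show ?case using Cons by auto
  qed
  then show ?thesis ..
qed

subsection \<open>Slices and product operators\<close>

text \<open>The unnormalised vector of \<open>AB\<close> that remains when \<open>S\<close> is found
  in basis state \<open>s\<close>.\<close>

definition slice :: "complex ^ ('d::finite \<times> 'd \<times> 'n::finite) \<Rightarrow> 'n \<Rightarrow> complex ^ ('d \<times> 'd)" where
  "slice \<psi> s = (\<chi> x. \<psi> $ (fst x, snd x, s))"

lemma ptrace_S_ketbra: "ptrace_S (ketbra \<psi>) = (\<Sum>s\<in>UNIV. ketbra (slice \<psi> s))"
  by (simp add: ptrace_S_def ketbra_def slice_def vec_eq_iff)

lemma ptrace_S_add: "ptrace_S (\<rho> + \<sigma>) = ptrace_S \<rho> + ptrace_S \<sigma>"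
  by (simp add: ptrace_S_def vec_eq_iff sum.distrib)

lemma ptrace_S_scaleR: "ptrace_S (c *\<^sub>R \<rho>) = c *\<^sub>R ptrace_S \<rho>"
  by (simp add: ptrace_S_def vec_eq_iff scaleR_sum_right)

lemma ptrace_S_sum_list: "ptrace_S (\<Sum>x\<leftarrow>xs. f x) = (\<Sum>x\<leftarrow>xs. ptrace_S (f x))"
  by (induction xs) (simp_all add: ptrace_S_add, simp add: ptrace_S_def vec_eq_iff)

lemma trace_ptrace_S: "trace (ptrace_S \<rho>) = trace \<rho>"
  by (simp add: trace_def ptrace_S_def sum_UNIV_prod)

lemma ptrace_S_ketbra_decomposition:
  obtains us where "(\<Sum>u\<leftarrow>us. ketbra u) = ptrace_S (ketbra \<psi>)"
    "(\<Sum>u\<leftarrow>us. G_pure u) = (\<Sum>s\<in>UNIV. G_pure (slice \<psi> s))"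
proof -
  obtain ss :: "'b list" where "distinct ss" "set ss = UNIV"
    using finite_distinct_list[of "UNIV :: 'b set"] by auto
  then show thesis
    by (intro that[of "map (slice \<psi>) ss"])
       (simp_all add: comp_def ptrace_S_ketbra sum_list_distinct_conv_sum_set)
qed

lemma sum_product3:
  fixes f :: "_ \<Rightarrow> 'a::comm_semiring_0"
  shows "sum f A * (sum g B * sum h C) = (\<Sum>a\<in>A. \<Sum>b\<in>B. \<Sum>c\<in>C. f a * (g b * h c))"
  by (simp only: sum_product) (simp only: sum_distrib_left)

lemma tensor3_mult: "tensor3 P Q R ** tensor3 P' Q' R' = tensor3 (P ** P') (Q ** Q') (R ** R')"
  by (simp add: tensor3_def matrix_matrix_mult_def vec_eq_iff sum_UNIV_prod mult.assoc sum_product3)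
     (simp add: mult_ac)

lemma tensor3_mult_vec_nth:
  "(tensor3 P Q R *v \<psi>) $ (i, j, s) =
    (\<Sum>a\<in>UNIV. \<Sum>b\<in>UNIV. \<Sum>t\<in>UNIV. P $ i $ a * Q $ j $ b * R $ s $ t * \<psi> $ (a, b, t))"
  by (simp add: tensor3_def matrix_vector_mult_def sum_UNIV_prod)

lemma mult_if_zero: "(if b then x else 0) * y = (if b then x * y else (0::'a::mult_zero))"
  "y * (if b then x else 0) = (if b then y * x else (0::'a::mult_zero))"
  by auto

lemma sum_if_const: "(\<Sum>t\<in>A. if b then g t else 0) = (if b then sum g A else 0)"
  by simp

lemma tensor3_mat_1: "tensor3 (mat 1) (mat 1) (mat 1) = mat 1"
  by (simp add: tensor3_def mat_def vec_eq_iff prod_eq_iff)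

text \<open>On coefficient matrices, a product operator acts from the left by \<open>P\<close> and
  from the right by the transpose of \<open>Q\<close>; \<open>S\<close> is untouched, so this
  happens slice by slice.\<close>

lemma coeff_matrix_slice_tensor3:
  "coeff_matrix (slice (tensor3 P Q (mat 1) *v \<psi>) s) =
    P ** coeff_matrix (slice \<psi> s) ** transpose Q"
proof -
  have "(tensor3 P Q (mat 1) *v \<psi>) $ (i, j, s) =
      (\<Sum>b\<in>UNIV. (\<Sum>a\<in>UNIV. P $ i $ a * \<psi> $ (a, b, s)) * Q $ j $ b)" for i j
  proof -
    have "(tensor3 P Q (mat 1) *v \<psi>) $ (i, j, s) =
        (\<Sum>a\<in>UNIV. \<Sum>b\<in>UNIV. P $ i $ a * Q $ j $ b * \<psi> $ (a, b, s))"
      by (simp add: tensor3_mult_vec_nth mat_def mult_if_zero)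
    also have "\<dots> = (\<Sum>b\<in>UNIV. \<Sum>a\<in>UNIV. P $ i $ a * Q $ j $ b * \<psi> $ (a, b, s))"
      by (rule sum.swap)
    finally show ?thesis by (simp add: sum_distrib_right sum_distrib_left mult_ac)
  qed
  then show ?thesis
    by (simp add: coeff_matrix_def slice_def matrix_matrix_mult_def transpose_def vec_eq_iff)
qed

lemma G_pure_slice_tensor3:
  "G_pure (slice (tensor3 P Q (mat 1) *v \<psi>) s) = det_root P * det_root Q * G_pure (slice \<psi> s)"
  by (simp add: G_pure_eq coeff_matrix_slice_tensor3 det_root_mult det_root_transpose)

text \<open>The reduced operator after applying \<open>R\<close> on \<open>S\<close> depends on
  \<open>R\<close> only through \<open>dagger R ** R\<close>, and linearly so; completeness then
  replaces the sum by the identity.\<close>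

lemma sum_ptrace_S_kraus:
  fixes \<psi> :: "complex ^ ('d::finite \<times> 'd \<times> 'n::finite)"
  assumes "(\<Sum>R\<leftarrow>Rs. dagger R ** R) = mat 1"
  shows "(\<Sum>R\<leftarrow>Rs. ptrace_S (ketbra (tensor3 (mat 1) (mat 1) R *v \<psi>))) = ptrace_S (ketbra \<psi>)"
proof -
  \<comment> \<open>\<open>E T\<close> is the partial trace over \<open>S\<close> of
    \<open>ketbra \<psi>\<close> multiplied from the left by \<open>T\<close> acting on
    \<open>S\<close>.\<close>
  define E :: "'n operator \<Rightarrow> ('d \<times> 'd) operator" where
    "E T = (\<chi> x y. \<Sum>t\<in>UNIV. \<Sum>u\<in>UNIV.
        T $ u $ t * (\<psi> $ (fst x, snd x, t) * cnj (\<psi> $ (fst y, snd y, u))))" for T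
  have E_sum: "(\<Sum>R\<leftarrow>Rs. E (h R)) = E (\<Sum>R\<leftarrow>Rs. h R)" for h :: "'n operator \<Rightarrow> _"
    by (induction Rs) (simp_all add: E_def vec_eq_iff sum.distrib distrib_right)
  have "ptrace_S (ketbra (tensor3 (mat 1) (mat 1) R *v \<psi>)) = E (dagger R ** R)" for R
  proof -
    have 1: "(tensor3 (mat 1) (mat 1) R *v \<psi>) $ (i, j, s) =
        (\<Sum>t\<in>UNIV. R $ s $ t * \<psi> $ (i, j, t))" for i j s
      by (simp add: tensor3_mult_vec_nth mat_def mult_if_zero sum_if_const)
    have "(\<Sum>s\<in>UNIV. (\<Sum>t\<in>UNIV. R $ s $ t * \<psi> $ (i, j, t)) *
          cnj (\<Sum>u\<in>UNIV. R $ s $ u * \<psi> $ (k, l, u))) =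
        (\<Sum>t\<in>UNIV. \<Sum>u\<in>UNIV. (\<Sum>s\<in>UNIV. cnj (R $ s $ u) * R $ s $ t) *
          (\<psi> $ (i, j, t) * cnj (\<psi> $ (k, l, u))))" for i j k l
    proof -
      have "(\<Sum>s\<in>UNIV. (\<Sum>t\<in>UNIV. R $ s $ t * \<psi> $ (i, j, t)) *
          cnj (\<Sum>u\<in>UNIV. R $ s $ u * \<psi> $ (k, l, u))) =
        (\<Sum>s\<in>UNIV. \<Sum>t\<in>UNIV. \<Sum>u\<in>UNIV. cnj (R $ s $ u) * R $ s $ t *
          (\<psi> $ (i, j, t) * cnj (\<psi> $ (k, l, u))))"
        by (simp add: sum_product mult_ac)
      also have "\<dots> = (\<Sum>t\<in>UNIV. \<Sum>s\<in>UNIV. \<Sum>u\<in>UNIV. cnj (R $ s $ u) * R $ s $ t *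
          (\<psi> $ (i, j, t) * cnj (\<psi> $ (k, l, u))))"
        by (rule sum.swap)
      also have "\<dots> = (\<Sum>t\<in>UNIV. \<Sum>u\<in>UNIV. \<Sum>s\<in>UNIV. cnj (R $ s $ u) * R $ s $ t *
          (\<psi> $ (i, j, t) * cnj (\<psi> $ (k, l, u))))"
        by (rule sum.cong[OF refl], rule sum.swap)
      finally show ?thesis by (simp only: sum_distrib_right)
    qed
    then show ?thesis
      by (simp add: ptrace_S_def ketbra_def E_def vec_eq_iff 1 matrix_matrix_mult_def dagger_def
          del: cnj_sum)
  qed
  then have "(\<Sum>R\<leftarrow>Rs. ptrace_S (ketbra (tensor3 (mat 1) (mat 1) R *v \<psi>))) = E (mat 1)"
    by (simp add: E_sum assms)
  also have "\<dots> = ptrace_S (ketbra \<psi>)"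
    by (simp add: E_def ptrace_S_def ketbra_def vec_eq_iff mat_def mult_if_zero)
  finally show ?thesis .
qed

text \<open>The completeness relation has trace \<open>CARD('d)\<close>; summing
  \<open>det_root_le\<close> over the family compares this with \<open>CARD('d)\<close> times the
  sum of the factors.\<close>

lemma sum_det_root_kraus_le:
  fixes Ms :: "('d::finite) operator list"
  assumes "(\<Sum>M\<leftarrow>Ms. dagger M ** M) = mat 1"
  shows "(\<Sum>M\<leftarrow>Ms. det_root M) \<le> 1"
proof -
  have "(\<Sum>i\<in>UNIV. (norm (M $ i))\<^sup>2) = Re (trace (dagger M ** M))" for M :: "'d operator"
  proof -
    have "trace (dagger M ** M) = (\<Sum>i\<in>UNIV. \<Sum>j\<in>UNIV. cnj (M $ j $ i) * M $ j $ i)"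
      by (simp add: trace_def matrix_matrix_mult_def dagger_def)
    also have "\<dots> = (\<Sum>j\<in>UNIV. \<Sum>i\<in>UNIV. cnj (M $ j $ i) * M $ j $ i)"
      by (rule sum.swap)
    also have "\<dots> = complex_of_real (\<Sum>j\<in>UNIV. (norm (M $ j))\<^sup>2)"
      by (simp add: of_real_norm_sq_vec mult.commute del: of_real_power)
    finally show ?thesis by simp
  qed
  then have "(\<Sum>M\<leftarrow>Ms. real CARD('d) * det_root M) \<le> (\<Sum>M\<leftarrow>Ms. Re (trace (dagger M ** M)))"
    by (intro sum_list_mono) (metis det_root_le)
  also have "\<dots> = real CARD('d)"
    using assms by (simp add: trace_I flip: Re_sum_list trace_sum_list)
  finally show ?thesis by (simp add: sum_list_const_mult)
qed

subsection \<open>Protocols acting on pure states\<close>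

text \<open>Every Kraus operator opens its own branch and nothing is renormalised, so probabilities
  sit in the norms of the vectors. The later operations still depend only on the outcome
  \<open>k\<close>, as in \<open>run_protocol\<close>.\<close>

primrec kraus_value ::
    "nat \<Rightarrow> ('d::finite \<times> 'd \<times> 'n::finite) protocol \<Rightarrow> complex ^ ('d \<times> 'd \<times> 'n) \<Rightarrow> real" where
  "kraus_value 0 P \<psi> = (\<Sum>s\<in>UNIV. G_pure (slice \<psi> s))"
| "kraus_value (Suc m) P \<psi> =
     (\<Sum>k\<leftarrow>[0..<length (P [])]. \<Sum>M\<leftarrow>P [] ! k. kraus_value m (\<lambda>h. P (k # h)) (M *v \<psi>))"

lemma kraus_value_nonneg: "0 \<le> kraus_value m P \<psi>"
  by (induction m arbitrary: P \<psi>) (auto intro!: sum_nonneg sum_list_nonneg G_pure_nonneg)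

lemma sum_list_concat_map: "(\<Sum>x\<leftarrow>concat (map g ys). f x) = (\<Sum>y\<leftarrow>ys. \<Sum>x\<leftarrow>g y. f x)"
  by (induction ys) simp_all

lemma sum_list_upt_concat:
  "(\<Sum>k\<leftarrow>[0..<length xss]. \<Sum>x\<leftarrow>xss ! k. f x) = (\<Sum>x\<leftarrow>concat xss. f x)"
proof -
  have "map (\<lambda>k. \<Sum>x\<leftarrow>xss ! k. f x) [0..<length xss] = map (\<lambda>xs. \<Sum>x\<leftarrow>xs. f x) xss"
    by (rule nth_equalityI) auto
  then show ?thesis using sum_list_concat_map[of f id xss] by simp
qed

text \<open>The bound \<open>f M\<close> does not depend on the outcome, so the double sum flattens
  to the list over which completeness is stated.\<close>

lemma kraus_value_Suc_le:
  assumes "\<And>k M. kraus_value m (\<lambda>h. P (k # h)) (e M *v \<psi>) \<le> f M"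
    and "P [] = map (map e) Ms"
  shows "kraus_value (Suc m) P \<psi> \<le> (\<Sum>M\<leftarrow>concat Ms. f M)"
proof -
  have "kraus_value (Suc m) P \<psi> = (\<Sum>k\<leftarrow>[0..<length Ms]. \<Sum>M\<leftarrow>Ms ! k.
      kraus_value m (\<lambda>h. P (k # h)) (e M *v \<psi>))"
    by (auto simp: assms(2) comp_def intro!: arg_cong[of _ _ sum_list])
  also have "\<dots> \<le> (\<Sum>k\<leftarrow>[0..<length Ms]. \<Sum>M\<leftarrow>Ms ! k. f M)"
    by (intro sum_list_mono assms(1))
  finally show ?thesis by (simp only: sum_list_upt_concat)
qed

text \<open>
  The operations of \<open>A\<close> and \<open>B\<close> performed so far are kept as one product operator applied to \<open>\<psi>\<close>,
  so that singular Kraus operators need no separate treatment.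
\<close>

lemma kraus_value_le:
  fixes P :: "('d::finite \<times> 'd \<times> 'n::finite) protocol"
  assumes "\<And>h. local_operation (P h)"
  shows "kraus_value m P (tensor3 A B (mat 1) *v \<psi>) \<le>
    det_root A * det_root B * G_upper (ptrace_S (ketbra \<psi>))"
  using assms
proof (induction m arbitrary: P A B \<psi>)
  case 0
  obtain us where us: "(\<Sum>u\<leftarrow>us. ketbra u) = ptrace_S (ketbra \<psi>)"
    "(\<Sum>u\<leftarrow>us. G_pure u) = (\<Sum>s\<in>UNIV. G_pure (slice \<psi> s))"
    by (rule ptrace_S_ketbra_decomposition)
  have "(\<Sum>s\<in>UNIV. G_pure (slice \<psi> s)) \<le> G_upper (ptrace_S (ketbra \<psi>))"
    using le_G_upper[OF us(1)] us(2) by simp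
  then show ?case
    by (simp add: G_pure_slice_tensor3 mult_left_mono det_root_nonneg flip: sum_distrib_left)
next
  case (Suc m)
  define X where "X = G_upper (ptrace_S (ketbra \<psi>))"
  have X: "0 \<le> X"
  proof -
    obtain us where us: "(\<Sum>u\<leftarrow>us. ketbra u) = ptrace_S (ketbra \<psi>)"
      by (rule ptrace_S_ketbra_decomposition)
    have "0 \<le> (\<Sum>u\<leftarrow>us. G_pure u)"
      by (auto intro!: sum_list_nonneg G_pure_nonneg)
    with le_G_upper[OF us] show ?thesis by (simp add: X_def)
  qed
  have IH: "kraus_value m (\<lambda>h. P (k # h)) (tensor3 A' B' (mat 1) *v \<psi>') \<le>
      det_root A' * det_root B' * G_upper (ptrace_S (ketbra \<psi>'))" for k A' B' \<psi>'
    by (rule Suc.IH) (rule Suc.prems)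
  have pos: "0 \<le> det_root A * det_root B"
    by (simp add: det_root_nonneg)
  \<comment> \<open>Completeness of an operation by \<open>A\<close> or \<open>B\<close> enters
    here: its determinant factors cannot increase the bound.\<close>
  have contract: "(\<Sum>M\<leftarrow>concat Ms. det_root M * (det_root A * det_root B * X)) \<le>
      det_root A * det_root B * X" if "complete_kraus Ms" for Ms :: "'d kraus_family"
  proof -
    have "(\<Sum>M\<leftarrow>concat Ms. det_root M) \<le> 1"
      using that by (intro sum_det_root_kraus_le) (simp add: complete_kraus_def)
    then have "(\<Sum>M\<leftarrow>concat Ms. det_root M) * (det_root A * det_root B * X) \<le>
        1 * (det_root A * det_root B * X)"
      using pos X by (intro mult_right_mono) auto
    then show ?thesis by (simp only: sum_list_mult_const mult_1)
  qed
  consider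
      (A) Ms where "complete_kraus Ms" "P [] = map (map (\<lambda>M. tensor3 M (mat 1) (mat 1))) Ms"
    | (B) Ms where "complete_kraus Ms" "P [] = map (map (\<lambda>M. tensor3 (mat 1) M (mat 1))) Ms"
    | (S) Ms where "complete_kraus Ms" "P [] = map (map (\<lambda>M. tensor3 (mat 1) (mat 1) M)) Ms"
    using Suc.prems[of "[]"] unfolding local_operation_def by blast
  then show ?case
  proof cases
    case A
    have "kraus_value (Suc m) P (tensor3 A B (mat 1) *v \<psi>) \<le>
        (\<Sum>M\<leftarrow>concat Ms. det_root M * (det_root A * det_root B * X))"
    proof (rule kraus_value_Suc_le[where e = "\<lambda>M. tensor3 M (mat 1) (mat 1)" and Ms = Ms])
      show "P [] = map (map (\<lambda>M. tensor3 M (mat 1) (mat 1))) Ms" by (fact A(2))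
    next
      fix k M
      show "kraus_value m (\<lambda>h. P (k # h))
          (tensor3 M (mat 1) (mat 1) *v (tensor3 A B (mat 1) *v \<psi>)) \<le>
          det_root M * (det_root A * det_root B * X)"
        \<comment> \<open>The new operator joins the accumulated factor of \<open>A\<close>, while
          \<psi> stays fixed.\<close>
        using IH[of k "M ** A" B \<psi>]
        by (simp add: matrix_vector_mul_assoc tensor3_mult det_root_mult X_def mult_ac)
    qed
    with contract[OF A(1)] show ?thesis unfolding X_def by linarith
  next
    case B
    have "kraus_value (Suc m) P (tensor3 A B (mat 1) *v \<psi>) \<le>
        (\<Sum>M\<leftarrow>concat Ms. det_root M * (det_root A * det_root B * X))"
    proof (rule kraus_value_Suc_le[where e = "\<lambda>M. tensor3 (mat 1) M (mat 1)" and Ms = Ms])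
      show "P [] = map (map (\<lambda>M. tensor3 (mat 1) M (mat 1))) Ms" by (fact B(2))
    next
      fix k M
      show "kraus_value m (\<lambda>h. P (k # h))
          (tensor3 (mat 1) M (mat 1) *v (tensor3 A B (mat 1) *v \<psi>)) \<le>
          det_root M * (det_root A * det_root B * X)"
        using IH[of k A "M ** B" \<psi>]
        by (simp add: matrix_vector_mul_assoc tensor3_mult det_root_mult X_def mult_ac)
    qed
    with contract[OF B(1)] show ?thesis unfolding X_def by linarith
  next
    case S
    \<comment> \<open>Operators on \<open>S\<close> commute with those on \<open>A\<close> and
      \<open>B\<close>, so they may act on \<psi> first and leave both determinant factors
      alone.\<close>
    let ?\<psi> = "\<lambda>R. tensor3 (mat 1) (mat 1) R *v \<psi>"
    have "kraus_value (Suc m) P (tensor3 A B (mat 1) *v \<psi>) \<le>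
        (\<Sum>R\<leftarrow>concat Ms. det_root A * det_root B * G_upper (ptrace_S (ketbra (?\<psi> R))))"
    proof (rule kraus_value_Suc_le[where e = "\<lambda>M. tensor3 (mat 1) (mat 1) M" and Ms = Ms])
      show "P [] = map (map (\<lambda>M. tensor3 (mat 1) (mat 1) M)) Ms" by (fact S(2))
    next
      fix k R
      show "kraus_value m (\<lambda>h. P (k # h))
          (tensor3 (mat 1) (mat 1) R *v (tensor3 A B (mat 1) *v \<psi>)) \<le>
          det_root A * det_root B * G_upper (ptrace_S (ketbra (?\<psi> R)))"
        using IH[of k A B "?\<psi> R"] by (simp add: matrix_vector_mul_assoc tensor3_mult)
    qed
    also have "\<dots> = det_root A * det_root B *
        (\<Sum>R\<leftarrow>concat Ms. G_upper (ptrace_S (ketbra (?\<psi> R))))"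
      by (rule sum_list_const_mult)
    \<comment> \<open>Superadditivity gathers the branches; their reduced operators then add up to
      the original one.\<close>
    also have "\<dots> \<le> det_root A * det_root B *
        G_upper (\<Sum>R\<leftarrow>concat Ms. ptrace_S (ketbra (?\<psi> R)))"
      by (intro mult_left_mono sum_list_G_upper_le pos) (metis ptrace_S_ketbra_decomposition)
    also have "(\<Sum>R\<leftarrow>concat Ms. ptrace_S (ketbra (?\<psi> R))) = ptrace_S (ketbra \<psi>)"
      using S(1) by (intro sum_ptrace_S_kraus) (simp add: complete_kraus_def)
    finally show ?thesis .
  qed
qed

subsection \<open>Protocols acting on mixed states\<close>

lemma ketbra_kraus: "M ** ketbra v ** dagger M = ketbra (M *v v)"
proof -
  have "(M ** ketbra v ** dagger M) $ i $ j = ketbra (M *v v) $ i $ j" for i j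
  proof -
    have "(M ** ketbra v ** dagger M) $ i $ j =
        (\<Sum>k\<in>UNIV. (\<Sum>l\<in>UNIV. M $ i $ l * v $ l) * (cnj (v $ k) * cnj (M $ j $ k)))"
      by (simp add: matrix_matrix_mult_def ketbra_def dagger_def sum_distrib_left sum_distrib_right mult_ac)
    also have "\<dots> = (\<Sum>l\<in>UNIV. M $ i $ l * v $ l) * cnj (\<Sum>k\<in>UNIV. M $ j $ k * v $ k)"
      by (simp add: sum_distrib_left mult_ac)
    finally show ?thesis
      by (simp add: ketbra_def matrix_vector_mult_def)
  qed
  then show ?thesis by (simp add: vec_eq_iff)
qed

lemma conjugation_sum_list:
  fixes M :: "('i::finite) operator"
  shows "M ** (\<Sum>v\<leftarrow>vs. f v) ** dagger M = (\<Sum>v\<leftarrow>vs. M ** f v ** dagger M)"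
proof (induction vs)
  case (Cons v vs)
  have "(X + Y) ** dagger M = X ** dagger M + Y ** dagger M" for X Y :: "'i operator"
    by (simp add: matrix_matrix_mult_def vec_eq_iff distrib_right sum.distrib)
  with Cons show ?case by (simp add: matrix_add_ldistrib)
qed simp

lemma conjugation_scaleR: "M ** (c *\<^sub>R \<rho>) ** dagger M = c *\<^sub>R (M ** \<rho> ** dagger M)"
  for \<rho> :: "('i::finite) operator"
  by (simp add: matrix_matrix_mult_def vec_eq_iff flip: scaleR_sum_right)

lemma apply_kraus_scaleR: "apply_kraus Ms (c *\<^sub>R \<rho>) = c *\<^sub>R apply_kraus Ms \<rho>"
  unfolding apply_kraus_def conjugation_scaleR by (induction Ms) (simp_all add: scaleR_add_right)

lemma apply_kraus_sum_ketbra: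
  "apply_kraus Ms (\<Sum>v\<leftarrow>vs. ketbra v) =
    (\<Sum>u\<leftarrow>concat (map (\<lambda>M. map (\<lambda>v. M *v v) vs) Ms). ketbra u)"
  by (simp add: apply_kraus_def conjugation_sum_list ketbra_kraus sum_list_concat_map comp_def)

lemma sum_list_swap: "(\<Sum>x\<leftarrow>xs. \<Sum>y\<leftarrow>ys. f x y) = (\<Sum>y\<leftarrow>ys. \<Sum>x\<leftarrow>xs. f x y)"
  for f :: "'a \<Rightarrow> 'b \<Rightarrow> 'c::comm_monoid_add"
  by (induction xs) (simp_all add: sum_list_addf)

text \<open>A list of vectors decomposing the input is pushed through the protocol: in each branch
  the images under the Kraus operators decompose the unnormalised outcome. The factor
  \<open>c\<close> collects the probabilities of the branch.\<close>

lemma run_protocol_le: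
  fixes \<rho> :: "('d::finite \<times> 'd \<times> 'n::finite) operator"
  assumes "(\<Sum>v\<leftarrow>vs. ketbra v) = c *\<^sub>R \<rho>" "trace \<rho> = 1" "c > 0"
  shows "c * (\<Sum>(q, \<sigma>)\<leftarrow>run_protocol m P \<rho>. q * G_conc (ptrace_S \<sigma>)) \<le>
    (\<Sum>v\<leftarrow>vs. kraus_value m P v)"
  using assms
proof (induction m arbitrary: P \<rho> vs c)
  case 0
  obtain ss :: "'n list" where ss: "distinct ss" "set ss = UNIV"
    using finite_distinct_list[of "UNIV :: 'n set"] by auto
  \<comment> \<open>The slices of all vectors decompose the reduced state and so bound its
    concurrence from above.\<close>
  define us where "us = concat (map (\<lambda>v. map (slice v) ss) vs)"
  have "(\<Sum>u\<leftarrow>us. ketbra u) = ptrace_S (\<Sum>v\<leftarrow>vs. ketbra v)"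
    using ss by (simp add: us_def sum_list_concat_map comp_def ptrace_S_sum_list
        ptrace_S_ketbra sum_list_distinct_conv_sum_set)
  then have "(\<Sum>u\<leftarrow>us. ketbra u) = c *\<^sub>R ptrace_S \<rho>"
    by (simp add: 0 ptrace_S_scaleR)
  then have "c * G_conc (ptrace_S \<rho>) \<le> (\<Sum>u\<leftarrow>us. G_pure u)"
    by (rule G_conc_le) (simp_all add: trace_ptrace_S 0)
  then show ?case
    using ss by (simp add: us_def sum_list_concat_map comp_def sum_list_distinct_conv_sum_set)
next
  case (Suc m)
  define Q where "Q = (\<lambda>k h. P (k # h))"
  define branch where "branch k =
     (let Ms = P [] ! k; p = outcome_prob Ms \<rho> in
         if p > 0
         then map (\<lambda>(q, \<sigma>). (p * q, \<sigma>)) (run_protocol m (Q k) ((1 / p) *\<^sub>R apply_kraus Ms \<rho>))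
         else [])" for k
  define val where "val E = (\<Sum>(q, \<sigma>)\<leftarrow>E. q * G_conc (ptrace_S \<sigma>))"
    for E :: "(real \<times> ('d \<times> 'd \<times> 'n) operator) list"
  have branch_le: "c * val (branch k) \<le> (\<Sum>M\<leftarrow>P [] ! k. \<Sum>v\<leftarrow>vs. kraus_value m (Q k) (M *v v))"
    for k
  proof -
    define Ms where "Ms = P [] ! k"
    define p where "p = outcome_prob Ms \<rho>"
    define us where "us = concat (map (\<lambda>M. map (\<lambda>v. M *v v) vs) Ms)"
    have us: "(\<Sum>u\<leftarrow>us. f u) = (\<Sum>M\<leftarrow>Ms. \<Sum>v\<leftarrow>vs. f (M *v v))"
      for f :: "complex ^ ('d \<times> 'd \<times> 'n) \<Rightarrow> real"
      by (simp add: us_def sum_list_concat_map comp_def)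
    show ?thesis
    proof (cases "p > 0")
      case True
      define \<rho>' where "\<rho>' = (1 / p) *\<^sub>R apply_kraus Ms \<rho>"
      have *: "(\<Sum>u\<leftarrow>us. ketbra u) = c *\<^sub>R apply_kraus Ms \<rho>"
        using apply_kraus_sum_ketbra[of Ms vs] Suc.prems(1)
        by (simp add: us_def apply_kraus_scaleR)
      \<comment> \<open>\<open>outcome_prob\<close> takes a real part; nothing is lost because a sum
        of \<open>ketbra\<close>s has real trace.\<close>
      have "trace (apply_kraus Ms \<rho>) = complex_of_real p"
      proof -
        have "apply_kraus Ms \<rho> = (1 / c) *\<^sub>R (\<Sum>u\<leftarrow>us. ketbra u)"
          using * \<open>c > 0\<close> by simp
        then have "trace (apply_kraus Ms \<rho>) = complex_of_real (1 / c) * (\<Sum>u\<leftarrow>us. trace (ketbra u))"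
          by (simp add: trace_scaleR trace_sum_list)
        also have "(\<Sum>u\<leftarrow>us. trace (ketbra u)) = complex_of_real (\<Sum>u\<leftarrow>us. (norm u)\<^sup>2)"
          by (induction us) (simp_all add: trace_ketbra)
        finally have "trace (apply_kraus Ms \<rho>) = complex_of_real (1 / c * (\<Sum>u\<leftarrow>us. (norm u)\<^sup>2))"
          by simp
        then show ?thesis by (simp add: p_def outcome_prob_def)
      qed
      then have tr: "trace \<rho>' = 1"
        using True by (simp add: \<rho>'_def trace_scaleR)
      \<comment> \<open>The same vectors serve for the normalised outcome state once the weight
        becomes \<open>c * p\<close>.\<close>
      have "(\<Sum>u\<leftarrow>us. ketbra u) = (c * p) *\<^sub>R \<rho>'"
        using True by (simp add: \<rho>'_def *)
      then have "(c * p) * val (run_protocol m (Q k) \<rho>') \<le> (\<Sum>u\<leftarrow>us. kraus_value m (Q k) u)"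
        unfolding val_def using True \<open>c > 0\<close> by (intro Suc.IH tr) auto
      moreover have "val (branch k) = p * val (run_protocol m (Q k) \<rho>')"
        using True by (simp add: val_def branch_def Let_def comp_def case_prod_unfold mult.assoc
            sum_list_const_mult flip: Ms_def p_def \<rho>'_def)
      ultimately show ?thesis by (simp add: us mult.assoc flip: Ms_def)
    next
      \<comment> \<open>The protocol drops this branch, whereas \<open>kraus_value\<close> keeps it
        with a nonnegative contribution.\<close>
      case False
      then have "val (branch k) = 0"
        by (simp add: val_def branch_def Let_def flip: Ms_def p_def)
      moreover have "0 \<le> (\<Sum>M\<leftarrow>Ms. \<Sum>v\<leftarrow>vs. kraus_value m (Q k) (M *v v))"
        by (auto intro!: sum_list_nonneg kraus_value_nonneg)
      ultimately show ?thesis by (simp add: Ms_def)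
    qed
  qed
  have "c * val (run_protocol (Suc m) P \<rho>) = (\<Sum>k\<leftarrow>[0..<length (P [])]. c * val (branch k))"
    unfolding val_def branch_def Q_def
    by (simp add: sum_list_concat_map sum_list_const_mult)
  also have "\<dots> \<le> (\<Sum>k\<leftarrow>[0..<length (P [])].
      \<Sum>M\<leftarrow>P [] ! k. \<Sum>v\<leftarrow>vs. kraus_value m (Q k) (M *v v))"
    by (rule sum_list_mono) (rule branch_le)
  also have "\<dots> = (\<Sum>k\<leftarrow>[0..<length (P [])].
      \<Sum>v\<leftarrow>vs. \<Sum>M\<leftarrow>P [] ! k. kraus_value m (Q k) (M *v v))"
    by (subst sum_list_swap) (rule refl)
  also have "\<dots> = (\<Sum>v\<leftarrow>vs. kraus_value (Suc m) P v)"
    by (subst sum_list_swap) (auto simp: Q_def intro!: arg_cong[of _ _ sum_list])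
  finally show ?case by (simp only: val_def)
qed

subsection \<open>Existence of pure-state decompositions\<close>

text \<open>The sesquilinear form of \<open>H\<close>, conjugate-linear in the first
  argument.\<close>

definition sesq :: "('i::finite) operator \<Rightarrow> complex ^ 'i \<Rightarrow> complex ^ 'i \<Rightarrow> complex" where
  "sesq H v w = (\<Sum>i\<in>UNIV. cnj (v $ i) * (H *v w) $ i)"

lemma sesq_add: "sesq H (u + v) w = sesq H u w + sesq H v w"
  "sesq H w (u + v) = sesq H w u + sesq H w v"
  by (simp_all add: sesq_def matrix_vector_right_distrib algebra_simps sum.distrib)

lemma mult_vec_axis: "(H *v axis i a) $ j = H $ j $ i * a"
  for H :: "complex ^ 'i::finite ^ 'j"
  by (simp add: matrix_vector_mult_def axis_def mult_if_zero if_distrib cong: if_cong)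

lemma sesq_axis: "sesq H (axis i a) w = cnj a * (H *v w) $ i"
  by (simp add: sesq_def axis_def mult_if_zero if_distrib if_distribR cong: if_cong)

lemma sesq_axis_right:
  assumes "dagger H = H"
  shows "sesq H w (axis i a) = a * cnj ((H *v w) $ i)"
proof -
  have "cnj (H $ i $ j) = H $ j $ i" for j
  proof -
    have "dagger H $ j $ i = H $ j $ i" by (simp add: assms)
    then show ?thesis by (simp add: dagger_def)
  qed
  moreover have "sesq H w (axis i a) = (\<Sum>j\<in>UNIV. cnj (w $ j) * (H $ j $ i * a))"
    by (simp add: sesq_def mult_vec_axis)
  ultimately show ?thesis
    by (simp add: matrix_vector_mult_def sum_distrib_left mult_ac)
qed

lemma sesq_ketbra: "sesq (ketbra u) v v = of_real ((cmod (\<Sum>i\<in>UNIV. cnj (u $ i) * v $ i))\<^sup>2)"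
proof -
  have "(ketbra u *v v) $ i = u $ i * (\<Sum>j\<in>UNIV. cnj (u $ j) * v $ j)" for i
    by (simp add: ketbra_def matrix_vector_mult_def sum_distrib_left mult_ac)
  then have "sesq (ketbra u) v v =
      (\<Sum>i\<in>UNIV. cnj (v $ i) * u $ i) * (\<Sum>j\<in>UNIV. cnj (u $ j) * v $ j)"
    by (simp add: sesq_def sum_distrib_right mult_ac)
  also have "(\<Sum>i\<in>UNIV. cnj (v $ i) * u $ i) = cnj (\<Sum>j\<in>UNIV. cnj (u $ j) * v $ j)"
    by (simp add: mult_ac)
  finally show ?thesis
    by (simp add: complex_norm_square mult.commute del: of_real_power)
qed

text \<open>
  Subtracting from \<open>H\<close> the rank one operator built from a nonzero column leaves a positive operator
  (a Schur complement) with one more zero row.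
\<close>

lemma positive_operator_decomposition:
  fixes H :: "('i::finite) operator"
  assumes "dagger H = H" "\<And>v. 0 \<le> Re (sesq H v v)"
  shows "\<exists>us. (\<Sum>u\<leftarrow>us. ketbra u) = H"
  using assms
proof (induction "card {i. H $ i \<noteq> 0}" arbitrary: H rule: less_induct)
  case less
  have herm: "cnj (H $ i $ j) = H $ j $ i" for i j
  proof -
    have "dagger H $ j $ i = H $ j $ i" by (simp add: less.prems(1))
    then show ?thesis by (simp add: dagger_def)
  qed
  \<comment> \<open>The quadratic form along a basis direction; both uses of positivity below choose
    a suitable \<open>a\<close>.\<close>
  have form: "Re (sesq H (v + axis i a) (v + axis i a)) =
      Re (sesq H v v) + 2 * Re (cnj a * (H *v v) $ i) + (cmod a)\<^sup>2 * Re (H $ i $ i)" for v i a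
  proof -
    have "sesq H (v + axis i a) (v + axis i a) = sesq H v v + a * cnj ((H *v v) $ i)
        + cnj a * (H *v v) $ i + cnj a * (H $ i $ i * a)"
      by (simp add: sesq_add sesq_axis sesq_axis_right less.prems(1) mult_vec_axis)
    moreover have "Re (cnj a * (H $ i $ i * a)) = (cmod a)\<^sup>2 * Re (H $ i $ i)"
      unfolding cmod_power2 by (simp add: power2_eq_square algebra_simps)
    ultimately show ?thesis by simp
  qed
  show ?case
  proof (cases "H = 0")
    case True
    then show ?thesis by (intro exI[of _ "[]"]) simp
  next
    case False
    then obtain i j where ij: "H $ i $ j \<noteq> 0"
      by (auto simp: vec_eq_iff)
    define h where "h = Re (H $ i $ i)"
    have hii: "H $ i $ i = of_real h"
      using herm[of i i] by (simp add: h_def complex_eq_iff)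
    have "h \<ge> 0"
      using less.prems(2)[of "axis i 1"] by (simp add: sesq_axis mult_vec_axis h_def)
    \<comment> \<open>If the diagonal entry vanished, the form would be affine in \<open>a\<close>
      and, because of the entry at \<open>(i, j)\<close>, unbounded below.\<close>
    moreover have "h \<noteq> 0"
    proof
      assume "h = 0"
      \<comment> \<open>Chosen so that the linear term,
        \<open>- 2 * (\<bar>Re (H $ j $ j)\<bar> + 1)\<close>, outweighs the diagonal entry at
        \<open>j\<close>.\<close>
      define t where "t = - (\<bar>Re (H $ j $ j)\<bar> + 1) / (cmod (H $ i $ j))\<^sup>2"
      define a where "a = of_real t * H $ i $ j"
      have "0 \<le> Re (sesq H (axis j 1 + axis i a) (axis j 1 + axis i a))"
        by (rule less.prems(2))
      also have "\<dots> = Re (H $ j $ j) + 2 * Re (cnj a * H $ i $ j)"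
        unfolding form using \<open>h = 0\<close> by (simp add: sesq_axis mult_vec_axis h_def)
      also have "Re (cnj a * H $ i $ j) = t * (cmod (H $ i $ j))\<^sup>2"
        unfolding cmod_power2 by (simp add: a_def power2_eq_square algebra_simps)
      also have "\<dots> = - (\<bar>Re (H $ j $ j)\<bar> + 1)"
        using ij by (simp add: t_def)
      finally show False by simp
    qed
    ultimately have h: "h > 0" by simp
    \<comment> \<open>With this scaling of column \<open>i\<close>, \<open>ketbra u\<close> agrees
      with \<open>H\<close> in row \<open>i\<close>.\<close>
    define u where "u = (\<chi> k. H $ k $ i / of_real (sqrt h))"
    have ku: "ketbra u $ k $ l = H $ k $ i * H $ i $ l / of_real h" for k l
      using h by (simp add: ketbra_def u_def herm flip: of_real_mult)
    define K where "K = H - ketbra u"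
    have "dagger K = K"
      by (simp add: K_def dagger_def vec_eq_iff ku herm mult.commute)
    moreover have "0 \<le> Re (sesq K v v)" for v
    proof -
      define y where "y = (H *v v) $ i"
      have K: "sesq K v v = sesq H v v - sesq (ketbra u) v v"
        by (simp add: K_def sesq_def matrix_vector_mult_diff_rdistrib algebra_simps sum_subtractf)
      have "(\<Sum>k\<in>UNIV. cnj (u $ k) * v $ k) = y / of_real (sqrt h)"
        using herm by (simp add: u_def y_def matrix_vector_mult_def sum_divide_distrib)
      then have su: "Re (sesq (ketbra u) v v) = (cmod y)\<^sup>2 / h"
        using h by (simp add: sesq_ketbra norm_divide power_divide)
      \<comment> \<open>This \<open>a\<close> minimises the form of \<open>H\<close> along direction
        \<open>i\<close>, and the minimum is exactly the form of \<open>K\<close> at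
        \<open>v\<close>.\<close>
      define a where "a = - y / of_real h"
      have "0 \<le> Re (sesq H (v + axis i a) (v + axis i a))"
        by (rule less.prems(2))
      also have "\<dots> = Re (sesq H v v) + 2 * Re (cnj a * y) + (cmod a)\<^sup>2 * h"
        by (simp add: form y_def h_def)
      also have "Re (cnj a * y) = - (cmod y)\<^sup>2 / h"
        unfolding cmod_power2
        by (simp add: a_def power2_eq_square diff_divide_distrib add_divide_distrib)
      also have "(cmod a)\<^sup>2 * h = (cmod y)\<^sup>2 / h"
        using h by (simp add: a_def norm_divide power_divide power2_eq_square)
      finally show ?thesis by (simp add: K su)
    qed
    \<comment> \<open>Zero rows of \<open>H\<close> stay zero in \<open>K\<close>, and row
      \<open>i\<close> becomes zero.\<close>
    moreover have "card {k. K $ k \<noteq> 0} < card {k. H $ k \<noteq> 0}"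
    proof (rule psubset_card_mono)
      have "K $ k = 0" if "H $ k = 0" for k
        using that by (simp add: K_def vec_eq_iff ku)
      moreover have "K $ i = 0"
        using h by (simp add: K_def vec_eq_iff ku hii)
      moreover have "H $ i \<noteq> 0" using ij by auto
      ultimately show "{k. K $ k \<noteq> 0} \<subset> {k. H $ k \<noteq> 0}" by blast
    qed simp
    ultimately obtain us where "(\<Sum>u\<leftarrow>us. ketbra u) = K"
      using less.hyps by blast
    then show ?thesis by (intro exI[of _ "u # us"]) (simp add: K_def)
  qed
qed

lemma pure_decompositions_nonempty:
  assumes "density_operator \<rho>"
  shows "pure_decompositions \<rho> \<noteq> {}"
proof -
  obtain us where "(\<Sum>u\<leftarrow>us. ketbra u) = \<rho>"
    using positive_operator_decomposition[of \<rho>] assms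
    by (auto simp: density_operator_def sesq_def)
  moreover have "trace \<rho> = 1" using assms by (simp add: density_operator_def)
  ultimately show ?thesis
    \<comment> \<open>Only the decomposition is wanted, so \<open>f\<close> is taken to be
      zero.\<close>
    using normalise_decomposition[of us 1 \<rho> "\<lambda>_. 0"] by auto
qed

section \<open>Comparison with the concurrence of assistance\<close>

lemma pure_value_le_1:
  assumes "D \<in> pure_decompositions \<sigma>"
  shows "(\<Sum>(p, \<phi>)\<leftarrow>D. p * G_pure \<phi>) \<le> 1"
proof -
  have "p * G_pure \<phi> \<le> p" if "(p, \<phi>) \<in> set D" for p \<phi>
  proof -
    have "0 \<le> p" "norm \<phi> = 1" using assms that by (auto simp: pure_decompositions_def)
    then show ?thesis using G_pure_le[of \<phi>] by (simp add: mult_left_le)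
  qed
  then have "(\<Sum>(p, \<phi>)\<leftarrow>D. p * G_pure \<phi>) \<le> (\<Sum>(p, \<phi>)\<leftarrow>D. p)"
    by (intro sum_list_mono) auto
  then show ?thesis using assms by (simp add: pure_decompositions_def)
qed

text \<open>Rescaling by \<open>q\<close> turns each unnormalised decomposition into one over which
  \<open>G_assist_pure\<close> takes its supremum.\<close>

lemma G_upper_le_G_assist_pure:
  assumes "norm \<psi> = 1" "q \<ge> 0"
  shows "G_upper (ptrace_S (ketbra (sqrt q *\<^sub>R \<psi>))) \<le> q * G_assist_pure \<psi>"
proof (rule G_upper_le)
  show "\<exists>us. (\<Sum>u\<leftarrow>us. ketbra u) = ptrace_S (ketbra (sqrt q *\<^sub>R \<psi>))"
    by (metis ptrace_S_ketbra_decomposition)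
next
  fix us
  assume "(\<Sum>u\<leftarrow>us. ketbra u) = ptrace_S (ketbra (sqrt q *\<^sub>R \<psi>))"
  then have us: "(\<Sum>u\<leftarrow>us. ketbra u) = q *\<^sub>R ptrace_S (ketbra \<psi>)"
    using assms by (simp add: ketbra_scaleR ptrace_S_scaleR)
  have tr: "trace (ptrace_S (ketbra \<psi>)) = 1"
    using assms by (simp add: trace_ptrace_S trace_ketbra)
  show "(\<Sum>u\<leftarrow>us. G_pure u) \<le> q * G_assist_pure \<psi>"
  proof (cases "q = 0")
    \<comment> \<open>Weight 0 cannot be normalised away, but then the trace bound already makes the
      left side at most 0.\<close>
    case True
    then show ?thesis
      using sum_G_pure_le_trace[of us] by (simp add: us trace_0[simplified])
  next
    case False
    then have q: "q > 0" using assms by simp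
    obtain D where D: "D \<in> pure_decompositions (ptrace_S (ketbra \<psi>))"
      "(\<Sum>(p, \<phi>)\<leftarrow>D. p * G_pure \<phi>) = (\<Sum>u\<leftarrow>us. G_pure u) / q"
      using normalise_decomposition[OF us tr q, of G_pure] G_pure_scaleR by blast
    have "bdd_above ((\<lambda>D. \<Sum>(p, \<phi>)\<leftarrow>D. p * G_pure \<phi>) `
        pure_decompositions (ptrace_S (ketbra \<psi>)))"
      by (rule bdd_aboveI2[of _ _ 1]) (rule pure_value_le_1)
    then have "(\<Sum>(p, \<phi>)\<leftarrow>D. p * G_pure \<phi>) \<le> G_assist_pure \<psi>"
      unfolding G_assist_pure_def by (intro cSUP_upper D(1))
    then show ?thesis using q by (simp add: D(2) field_simps)
  qed
qed

lemma locc_value_le: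
  fixes \<rho> :: "('d::finite \<times> 'd \<times> 'n::finite) operator"
  assumes "trace \<rho> = 1" "E \<in> locc_ensembles \<rho>" "D \<in> pure_decompositions \<rho>"
  shows "(\<Sum>(q, \<sigma>)\<leftarrow>E. q * G_conc (ptrace_S \<sigma>)) \<le> (\<Sum>(q, \<psi>)\<leftarrow>D. q * G_assist_pure \<psi>)"
proof -
  obtain m P where E: "E = run_protocol m P \<rho>" and P: "\<And>h. local_operation (P h)"
    using assms(2) by (auto simp: locc_ensembles_def)
  have D: "q \<ge> 0 \<and> norm \<psi> = 1" if "(q, \<psi>) \<in> set D" for q \<psi>
    using assms(3) that by (auto simp: pure_decompositions_def)
  \<comment> \<open>The accumulated product operator starts as the identity, with determinant
    factors 1.\<close>
  have kv: "kraus_value m P \<psi> \<le> G_upper (ptrace_S (ketbra \<psi>))" for \<psi>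
    using kraus_value_le[where A = "mat 1" and B = "mat 1", OF P]
    by (simp add: tensor3_mat_1 det_root_1)
  have "(\<Sum>(q, \<sigma>)\<leftarrow>E. q * G_conc (ptrace_S \<sigma>)) \<le>
      (\<Sum>v\<leftarrow>map (\<lambda>(q, \<psi>). sqrt q *\<^sub>R \<psi>) D. kraus_value m P v)"
    using run_protocol_le[of "map (\<lambda>(q, \<psi>). sqrt q *\<^sub>R \<psi>) D" 1 \<rho> m P]
      unnormalise_decomposition[OF assms(3)] assms(1)
    by (simp add: E)
  also have "\<dots> = (\<Sum>(q, \<psi>)\<leftarrow>D. kraus_value m P (sqrt q *\<^sub>R \<psi>))"
    by (simp add: comp_def case_prod_unfold)
  also have "\<dots> \<le> (\<Sum>(q, \<psi>)\<leftarrow>D. q * G_assist_pure \<psi>)"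
    using D kv G_upper_le_G_assist_pure by (intro sum_list_mono) (fastforce intro: order_trans)
  finally show ?thesis .
qed

text \<open>Zero rounds suffice, but the protocol must still name a local operation for every
  history; the identity on \<open>A\<close> fills this role.\<close>

lemma locc_ensembles_nonempty:
  fixes \<rho> :: "('d::finite \<times> 'd \<times> 'n::finite) operator"
  shows "locc_ensembles \<rho> \<noteq> {}"
proof -
  have "complete_kraus [[mat 1 :: 'd operator]]"
    by (simp add: complete_kraus_def) (simp add: dagger_def mat_def vec_eq_iff)
  then have "local_operation [[tensor3 (mat 1 :: 'd operator) (mat 1) (mat 1 :: 'n operator)]]"
    unfolding local_operation_def by (intro disjI1 exI[of _ "[[mat 1]]"]) simp
  then have "run_protocol 0 (\<lambda>_. [[tensor3 (mat 1) (mat 1) (mat 1)]]) \<rho> \<in> locc_ensembles \<rho>"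
    unfolding locc_ensembles_def by blast
  then show ?thesis by blast
qed

theorem theorem2:
  fixes \<rho> :: "('d::finite \<times> 'd \<times> 'n::finite) operator"
  assumes "CARD('d) \<ge> 2"
    and "density_operator \<rho>"
  shows "assisted_G \<rho> \<le> G_assist \<rho>"
  unfolding assisted_G_def G_assist_def
\<comment> \<open>A supremum is compared with an infimum, so every ensemble is tested against every
  decomposition, both sets being nonempty.\<close>
proof (intro cSUP_least cINF_greatest locc_ensembles_nonempty pure_decompositions_nonempty)
  show "density_operator \<rho>" by (fact assms)
qed (use assms in \<open>auto simp: density_operator_def intro!: locc_value_le\<close>)

end
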